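(* Let $s_1,s_2\in\mathbb{R}$, $0<p_1,p_2<\infty$, $0<q_2\le\infty$ and define $\alpha=p_1\big(\frac{s_2-s_1}{d}-\frac1{p_2}\big)+1$. For $\Gamma\subset\mathcal{D}$ (the dyadic cubes of $\mathbb{R}^d$) define $\nu_\alpha(\Gamma)=\sum_{Q\in\Gamma}|Q|^\alpha$. Given $\tau\in(0,\infty)$, $$\ell^{\tau,\tau}(\mathbf{u},\nu_\alpha)=b^\gamma_{\tau,\tau}\quad\text{(with equal quasi-norms)},$$ where $\mathbf{u}=\{\|\mathbf{e}_Q\|_{f^{s_2}_{p_2,q_2}}\}_{Q\in\mathcal{D}}$ and $\gamma=s_1+d\big(\frac1\tau-\frac1{p_1}\big)(1-\alpha)$.
   Context: $\mathcal{D}$ is the set of dyadic cubes $Q_{j,k}=2^{-j}([0,1)^d+k)$, $j\in\mathbb{Z}$, $k\in\mathbb{Z}^d$, of $\mathbb{R}^d$; $|Q|$ is the Lebesgue measure of $Q$; $S=\mathbb{C}^{\mathcal{D}}$; $\mathbf{e}_Q\in S$ has entry $1$ at $Q$ and $0$ elsewhere. For $s\in\mathbb{R}$, $0<p<\infty$, $0<r\le\infty$, $f^s_{p,r}$ is the space of $\mathbf{s}=\{s_Q\}\in S$ with $$\|\mathbf{s}\|_{f^s_{p,r}}=\Big\|\Big[\sum_{Q\in\mathcal{D}}\big(|Q|^{-s/d+1/r-1/2}|s_Q|\chi^{(r)}_Q(\cdot)\big)^r\Big]^{1/r}\Big\|_{L^p(\mathbb{R}^d)}<\infty,\qquad\chi^{(r)}_Q=\chi_Q|Q|^{-1/r}$$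 (supremum instead of the inner sum, and $1/r=0$, if $r=\infty$). For $s\in\mathbb{R}$, $0<p,r\le\infty$, $b^s_{p,r}$ is the space of $\mathbf{s}\in S$ with $$\|\mathbf{s}\|_{b^s_{p,r}}=\Big[\sum_{j\in\mathbb{Z}}\Big(\sum_{|Q|=2^{-jd}}(|Q|^{-s/d+1/p-1/2}|s_Q|)^p\Big)^{r/p}\Big]^{1/r}<\infty$$ (obvious modifications if $p$ or $r$ is $\infty$). For a measure $\nu$ on $\mathcal{D}$ and $\mathbf{s}\in S$, $\mathbf{s}^\ast_\nu(t)=\inf\{\lambda>0:\nu(\{Q:|s_Q|>\lambda\})\le t\}$. For $0<\tau,\mu<\infty$ and a positive sequence $\mathbf{u}=\{u_Q\}$, $\ell^{\tau,\mu}(\mathbf{u},\nu)$ is the set of $\mathbf{s}\in S$ such that, with $\mathbf{d}=\{u_Qs_Q\}_{Q\in\mathcal{D}}$, $\|\mathbf{s}\|_{\ell^{\tau,\mu}(\mathbf{u},\nu)}=\big(\int_0^\infty[t^{1/\tau}\mathbf{d}^\ast_\nu(t)]^\mu\frac{dt}{t}\big)^{1/\mu}<\infty$; for $\mu=\tau$ this is $\big(\sum_{Q\in\mathcal{D}}|u_Qs_Q|^\tau\nu(Q)\big)^{1/\tau}$. *)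

theory Defs
  imports "HOL-Analysis.Analysis"
begin

section \<open>Dyadic cubes and sequences\<close>

text \<open>The dimension is the cardinality of the index type. Dyadic cubes are kept as subsets of the
  space, so sequences over them are functions on sets of points; outside the dyadic cubes these
  functions have the fixed value \<^const>\<open>undefined\<close>, so that equality of sequences means equality
  of their entries.\<close>

definition dyadic_cube :: "int \<Rightarrow> int ^ 'n \<Rightarrow> (real ^ 'n::finite) set" where
  "dyadic_cube j k =
     (\<lambda>x. (2 powi (- j)) *\<^sub>R (x + (\<chi> i. real_of_int (k $ i)))) ` {x. \<forall>i. x $ i \<in> {0..<1}}"

definition dyadic_cubes :: "(real ^ 'n::finite) set set" where
  "dyadic_cubes = {dyadic_cube j k |j k. True}"

abbreviation vol :: "(real ^ 'n::finite) set \<Rightarrow> real" where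
  "vol Q \<equiv> measure lborel Q"

type_synonym 'n dyadic_seq = "(real ^ 'n) set \<Rightarrow> complex"

definition dyadic_seqs :: "'n::finite dyadic_seq set" where
  "dyadic_seqs = dyadic_cubes \<rightarrow>\<^sub>E UNIV"

definition unit_seq :: "(real ^ 'n::finite) set \<Rightarrow> 'n dyadic_seq" where
  "unit_seq Q = (\<lambda>P\<in>dyadic_cubes. if P = Q then 1 else 0)"


section \<open>Quasi-norms\<close>

text \<open>Quasi-norms take values in \<^typ>\<open>ennreal\<close>. Exponents that may be infinite have type
  \<^typ>\<open>ennreal\<close> as well; \<^term>\<open>1 / r = (0::ennreal)\<close> for infinite \<open>r\<close>.\<close>

text \<open>The power below is only used with \<open>a > 0\<close>.\<close>

definition enn_powr :: "ennreal \<Rightarrow> real \<Rightarrow> ennreal" where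
  "enn_powr x a = (if x = \<infinity> then \<infinity> else ennreal (enn2real x powr a))"

definition lr_norm :: "ennreal \<Rightarrow> 'i set \<Rightarrow> ('i \<Rightarrow> ennreal) \<Rightarrow> ennreal" where
  "lr_norm r I a =
     (if r = \<infinity> then (SUP i\<in>I. a i)
      else enn_powr (\<integral>\<^sup>+ i. enn_powr (a i) (enn2real r) \<partial>count_space I) (1 / enn2real r))"

definition Lp_norm :: "real \<Rightarrow> ('a::euclidean_space \<Rightarrow> ennreal) \<Rightarrow> ennreal" where
  "Lp_norm p F = enn_powr (\<integral>\<^sup>+ x. enn_powr (F x) p \<partial>lborel) (1 / p)"

definition chi :: "ennreal \<Rightarrow> (real ^ 'n::finite) set \<Rightarrow> real ^ 'n \<Rightarrow> real" where
  "chi r Q x = indicator Q x * vol Q powr (- enn2real (1 / r))"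

definition f_norm :: "real \<Rightarrow> real \<Rightarrow> ennreal \<Rightarrow> 'n::finite dyadic_seq \<Rightarrow> ennreal" where
  "f_norm s p r S =
     Lp_norm p (\<lambda>x. lr_norm r dyadic_cubes (\<lambda>Q.
       ennreal (vol Q powr (- s / real CARD('n) + enn2real (1 / r) - 1/2) * cmod (S Q) * chi r Q x)))"

definition b_norm :: "real \<Rightarrow> ennreal \<Rightarrow> ennreal \<Rightarrow> 'n::finite dyadic_seq \<Rightarrow> ennreal" where
  "b_norm s p r S =
     lr_norm r UNIV (\<lambda>j::int.
       lr_norm p {Q \<in> dyadic_cubes. vol Q = 2 powi (- j * int CARD('n))} (\<lambda>Q.
         ennreal (vol Q powr (- s / real CARD('n) + enn2real (1 / p) - 1/2) * cmod (S Q))))"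

definition b_space :: "real \<Rightarrow> ennreal \<Rightarrow> ennreal \<Rightarrow> 'n::finite dyadic_seq set" where
  "b_space s p r = {S \<in> dyadic_seqs. b_norm s p r S < \<infinity>}"


section \<open>Weighted Lorentz spaces\<close>

text \<open>The infimum is taken in \<^typ>\<open>ennreal\<close>, where the infimum of the empty set is \<open>\<infinity>\<close>.\<close>

definition rearrangement ::
    "(real ^ 'n::finite) set measure \<Rightarrow> 'n dyadic_seq \<Rightarrow> real \<Rightarrow> ennreal" where
  "rearrangement \<nu> S t =
     (INF l\<in>{l::real. l > 0 \<and> emeasure \<nu> {Q \<in> dyadic_cubes. cmod (S Q) > l} \<le> ennreal t}.
        ennreal l)"

definition lorentz_norm ::
    "real \<Rightarrow> real \<Rightarrow> ((real ^ 'n::finite) set \<Rightarrow> real) \<Rightarrow> (real ^ 'n) set measure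
       \<Rightarrow> 'n dyadic_seq \<Rightarrow> ennreal" where
  "lorentz_norm \<tau> \<mu> u \<nu> S =
     enn_powr
       (\<integral>\<^sup>+ t\<in>{0<..}.
          enn_powr (ennreal (t powr (1 / \<tau>)) *
                    rearrangement \<nu> (\<lambda>Q\<in>dyadic_cubes. of_real (u Q) * S Q) t) \<mu>
          * ennreal (1 / t) \<partial>lborel)
       (1 / \<mu>)"

definition lorentz_space ::
    "real \<Rightarrow> real \<Rightarrow> ((real ^ 'n::finite) set \<Rightarrow> real) \<Rightarrow> (real ^ 'n) set measure
       \<Rightarrow> 'n dyadic_seq set" where
  "lorentz_space \<tau> \<mu> u \<nu> = {S \<in> dyadic_seqs. lorentz_norm \<tau> \<mu> u \<nu> S < \<infinity>}"

definition nu :: "real \<Rightarrow> (real ^ 'n::finite) set measure" where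
  "nu \<alpha> = point_measure dyadic_cubes (\<lambda>Q. ennreal (vol Q powr \<alpha>))"

section \<open>Basic facts\<close>

text \<open>The norms of unit sequences are finite and positive, so \<^const>\<open>enn2real\<close> turns them into a
  genuine positive real sequence without loss.\<close>

lemma dyadic_cube_eq:
  fixes k :: "int ^ 'n::finite"
  shows "dyadic_cube j k =
     {x. \<forall>i. 2 powi (-j) * of_int (k$i) \<le> x$i \<and> x$i < 2 powi (-j) * (of_int (k$i) + 1)}"
    (is "_ = ?R")
proof (rule set_eqI)
  fix x :: "real^'n"
  have p: "(2::real) powi (-j) > 0" by simp
  show "x \<in> dyadic_cube j k \<longleftrightarrow> x \<in> ?R"
  proof
    assume "x \<in> dyadic_cube j k"
    then show "x \<in> ?R" using p by (auto simp: dyadic_cube_def algebra_simps mult_less_cancel_left)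
  next
    assume R: "x \<in> ?R"
    define y :: "real^'n" where "y = (\<chi> i. x$i * 2 powi j - of_int (k$i))"
    have pm: "(2::real) powi (-j) * 2 powi j = 1" by (simp add: power_int_minus)
    have xx: "x$i = 2 powi (-j) * (x$i * 2 powi j)" for i using pm by (simp add: ac_simps)
    have "y \<in> {x. \<forall>i. x $ i \<in> {0..<1}}"
    proof (safe)
      fix i
      have "2 powi (-j) * of_int (k$i) \<le> 2 powi (-j) * (x$i * 2 powi j)" 
        "2 powi (-j) * (x$i * 2 powi j) < 2 powi (-j) * (of_int (k$i) + 1)"
        using R xx[of i] by (metis (mono_tags, lifting) mem_Collect_eq)+
      then show "y $ i \<in> {0..<1}" using p by (simp only: mult_le_cancel_left_pos mult_less_cancel_left_pos y_def) auto
    qed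
    moreover have "x = (2 powi (-j)) *\<^sub>R (y + (\<chi> i. of_int (k$i)))"
      using xx by (simp add: y_def vec_eq_iff mult.commute)
    ultimately show "x \<in> dyadic_cube j k" unfolding dyadic_cube_def by blast
  qed
qed

lemma dyadic_cube_borel: "dyadic_cube j (k :: int ^ 'n::finite) \<in> sets borel"
  unfolding dyadic_cube_eq by measurable

lemma emeasure_dyadic_cube: "emeasure lborel (dyadic_cube j (k :: int ^ 'n::finite)) = ennreal ((2 powi (-j))^CARD('n))"
proof -
  let ?a = "(\<chi> i. 2 powi (-j) * of_int (k$i)) :: real^'n"
  let ?b = "(\<chi> i. 2 powi (-j) * (of_int (k$i)+1)) :: real^'n"
  have le: "?a \<bullet> b \<le> ?b \<bullet> b" if "b \<in> Basis" for b
    using that by (auto simp: Basis_vec_def inner_axis)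
  have pr: "(\<Prod>b\<in>Basis. (?b - ?a) \<bullet> b) = (2 powi (-j))^CARD('n)"
    by (simp add: Basis_vec_def inner_axis prod.UNION_disjoint algebra_simps axis_eq_axis)
  have m: "box ?a ?b \<subseteq> dyadic_cube j k" "dyadic_cube j k \<subseteq> cbox ?a ?b"
    unfolding dyadic_cube_eq by (force simp: mem_box_cart intro: less_imp_le)+
  have "emeasure lborel (box ?a ?b) \<le> emeasure lborel (dyadic_cube j k)" 
       "emeasure lborel (dyadic_cube j k) \<le> emeasure lborel (cbox ?a ?b)"
    using m dyadic_cube_borel by (auto intro!: emeasure_mono)
  moreover have "emeasure lborel (box ?a ?b) = ennreal ((2 powi (-j))^CARD('n))"
   "emeasure lborel (cbox ?a ?b) = ennreal ((2 powi (-j))^CARD('n))"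
    unfolding pr[symmetric] using le by (simp_all add: emeasure_lborel_box_eq emeasure_lborel_cbox_eq)
  ultimately show ?thesis by simp
qed

lemma dyadic_cubes_facts: "Q \<in> dyadic_cubes \<Longrightarrow> vol Q > 0 \<and> emeasure lborel Q = ennreal (vol Q) \<and> Q \<in> sets borel"
  by (auto simp: dyadic_cubes_def emeasure_dyadic_cube measure_def dyadic_cube_borel)

lemma lr_norm_single:
  assumes "i \<in> I" "0 < r" "\<And>j. j \<in> I \<Longrightarrow> j \<noteq> i \<Longrightarrow> a j = 0" "a i < \<infinity>"
  shows "lr_norm r I a = a i"
proof (cases "r = \<infinity>")
  case True
  have "(SUP i\<in>I. a i) = a i"
  proof (intro antisym SUP_least)
    show "a j \<le> a i" if "j \<in> I" for j
      using assms(3)[OF that] by (cases "j = i") auto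
  qed (use assms in \<open>auto intro: SUP_upper\<close>)
  then show ?thesis using True by (simp add: lr_norm_def)
next
  case False
  define c where "c = enn2real r"
  have c: "c > 0" using assms(2) False by (simp add: c_def enn2real_positive_iff top.not_eq_extremum)
  have "(\<integral>\<^sup>+ i. enn_powr (a i) c \<partial>count_space I) = (\<Sum>j\<in>{i}. enn_powr (a j) c)"
    using assms by (intro nn_integral_count_space') (auto simp: enn_powr_def)
  then have "(\<integral>\<^sup>+ i. enn_powr (a i) c \<partial>count_space I) = enn_powr (a i) c" by simp
  then show ?thesis using False assms(4) c
    unfolding lr_norm_def c_def[symmetric] by (auto simp: enn_powr_def powr_powr less_top[symmetric])
qed

lemma f_norm_unit_seq:
  fixes Q :: "(real ^ 'n::finite) set"
  assumes Q: "Q \<in> dyadic_cubes" and p: "0 < p" and r: "0 < r"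
  shows "f_norm s p r (unit_seq Q) = ennreal (vol Q powr (- s / real CARD('n) + 1 / p - 1/2))"
proof -
  define a where "a = vol Q powr (- s / real CARD('n) - 1/2)"
  have vp: "vol Q > 0" "emeasure lborel Q = ennreal (vol Q)" "Q \<in> sets borel" using dyadic_cubes_facts[OF Q] by auto
  have inn: "lr_norm r dyadic_cubes (\<lambda>P.
       ennreal (vol P powr (- s / real CARD('n) + enn2real (1 / r) - 1/2) * cmod (unit_seq Q P) * chi r P x))
      = ennreal (a * indicator Q x)" for x :: "real^'n"
  proof (subst lr_norm_single[OF Q r])
    show "ennreal (vol Q powr (- s / real CARD('n) + enn2real (1 / r) - 1/2) * cmod (unit_seq Q Q) * chi r Q x)
      = ennreal (a * indicator Q x)"
      using Q vp by (simp add: unit_seq_def chi_def a_def powr_add[symmetric] split: split_indicator)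
  qed (auto simp: unit_seq_def)
  have "(\<integral>\<^sup>+ x. enn_powr (ennreal (a * indicator Q x)) p \<partial>lborel) = (\<integral>\<^sup>+ x. ennreal (a powr p) * indicator Q x \<partial>lborel)"
    using p by (intro nn_integral_cong) (auto simp: enn_powr_def a_def split: split_indicator)
  also have "\<dots> = ennreal (a powr p * vol Q)"
    using vp by (subst nn_integral_cmult_indicator) (auto simp: ennreal_mult)
  finally show ?thesis unfolding f_norm_def inn Lp_norm_def
    using vp p by (simp add: enn_powr_def a_def powr_mult powr_powr powr_add[symmetric] algebra_simps)
qed

lemma emeasure_nu:
  assumes "\<Gamma> \<subseteq> dyadic_cubes"
  shows "emeasure (nu \<alpha>) \<Gamma> = (\<integral>\<^sup>+ Q. ennreal (vol Q powr \<alpha>) \<partial>count_space \<Gamma>)"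
proof -
  have "\<Gamma> \<inter> dyadic_cubes = \<Gamma>" using assms by blast
  then show ?thesis
    using assms by (simp add: nu_def point_measure_def emeasure_density
        nn_integral_restrict_space[symmetric] restrict_count_space)
qed

end

theory Submission
  imports Defs
begin

text \<open>Since \<open>u\<^sub>Q\<close> is a power of \<open>|Q|\<close>, both quasi-norms reduce to the same weighted
  \<open>\<ell>\<^sup>\<tau>\<close> sum over the dyadic cubes. On the Lorentz side this is the layer cake formula: right
  continuity of the distribution function gives \<open>\<lambda> < d\<^sup>*(t)\<close> iff \<open>t < \<nu>(|d| > \<lambda>)\<close>, so the
  integral of \<open>d\<^sup>*(t)\<^sup>\<tau>\<close> turns into that of \<open>|d|\<^sup>\<tau>\<close> by two applications of
  Tonelli's theorem. On the Besov side the side lengths partition the dyadic cubes.\<close>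

section \<open>Powers and interval lengths in the extended nonnegative reals\<close>

lemma enn_powr_ennreal: "0 \<le> x \<Longrightarrow> enn_powr (ennreal x) a = ennreal (x powr a)"
  by (simp add: enn_powr_def)

lemma enn_powr_inverse: "0 < a \<Longrightarrow> enn_powr (enn_powr x (1 / a)) a = x"
  by (cases x) (auto simp: enn_powr_def powr_powr)

lemma enn_powr_mult_ennreal:
  assumes "0 < c" "0 < a"
  shows "enn_powr (ennreal c * x) a = ennreal (c powr a) * enn_powr x a"
  using assms
  by (cases x) (auto simp: enn_powr_def ennreal_mult_top powr_mult simp flip: ennreal_mult)

text \<open>Moves the exponent from the value to the level, so that superlevel sets of a power
  become superlevel sets of the function itself.\<close>

lemma less_enn_powr_iff:
  assumes "0 < s" "0 < a"
  shows "ennreal s < enn_powr x a \<longleftrightarrow> ennreal (s powr (1 / a)) < x"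
proof (cases x)
  case (real r)
  have "s < r powr a \<longleftrightarrow> s powr (1 / a) < r"
  proof -
    have "s powr (1 / a) < r \<longleftrightarrow> (s powr (1 / a)) powr a < r powr a"
      using assms real powr_less_mono2[of a "s powr (1 / a)" r] powr_mono2[of a r "s powr (1 / a)"]
      by (auto simp: not_less[symmetric])
    then show ?thesis using assms by (simp add: powr_powr)
  qed
  then show ?thesis using assms real by (simp add: enn_powr_ennreal ennreal_less_iff)
qed (simp add: enn_powr_def)

text \<open>The set is the interval from 0 to \<open>x\<close>, or the half-line if \<open>x\<close>
  is infinite. Writing a value as such a length opens the way to Tonelli.\<close>

lemma nn_integral_indicator_less_ennreal:
  "(\<integral>\<^sup>+ s. indicator {s. 0 < s \<and> ennreal s < x} s \<partial>lborel) = x"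
proof (cases x)
  case (real r)
  then have "{s. 0 < s \<and> ennreal s < x} = {0<..<r}"
    by (auto simp: ennreal_less_iff)
  with real show ?thesis by simp
next
  case top
  have "{s::real. 0 < s \<and> ennreal s < x} = {0<..}"
    using top by auto
  moreover have "emeasure lborel {0::real<..} = \<infinity>"
  proof -
    have "of_nat n \<le> emeasure lborel {0::real<..}" for n
    proof -
      have "emeasure lborel {0<..<real n} \<le> emeasure lborel {0::real<..}"
        by (intro emeasure_mono) auto
      then show ?thesis by (simp add: ennreal_of_nat_eq_real_of_nat)
    qed
    then have "(SUP n. of_nat n) \<le> emeasure lborel {0::real<..}"
      by (intro SUP_least)
    then show ?thesis
      by (simp add: ennreal_SUP_of_nat_eq_top top_unique)
  qed
  ultimately show ?thesis using top by simp
qed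

section \<open>The layer cake formula for rearrangements, over a general sigma-finite
  measure\<close>

definition decr_rearrangement :: "'a measure \<Rightarrow> ('a \<Rightarrow> real) \<Rightarrow> real \<Rightarrow> ennreal" where
  "decr_rearrangement M f t =
     (INF l\<in>{l::real. l > 0 \<and> emeasure M {x \<in> space M. f x > l} \<le> ennreal t}. ennreal l)"

text \<open>If the superlevel set at \<open>l\<close> has measure at most \<open>t\<close>, then
  \<open>l\<close> itself competes in the infimum. The converse is right continuity of the
  distribution function, obtained from levels decreasing to \<open>l\<close>.\<close>

lemma less_decr_rearrangement_iff:
  assumes [measurable]: "f \<in> borel_measurable M" and l: "0 < l"
  shows "ennreal l < decr_rearrangement M f t \<longleftrightarrow> ennreal t < emeasure M {x \<in> space M. f x > l}"
proof (rule iffI; rule ccontr)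
  assume "ennreal l < decr_rearrangement M f t"
    and "\<not> ennreal t < emeasure M {x \<in> space M. f x > l}"
  moreover from this l have "decr_rearrangement M f t \<le> ennreal l"
    unfolding decr_rearrangement_def by (intro INF_lower) auto
  ultimately show False by simp
next
  assume A: "ennreal t < emeasure M {x \<in> space M. f x > l}"
    and B: "\<not> ennreal l < decr_rearrangement M f t"
  \<comment> \<open>An infimum at most \<open>l\<close> only yields admissible levels below
    \<open>l + 1 / real (Suc n)\<close>, for every \<open>n\<close>. So each \<open>A n\<close> has
    measure at most \<open>t\<close>, and these sets increase to the superlevel set at
    \<open>l\<close>.\<close>
  define A where "A n = {x \<in> space M. f x > l + 1 / real (Suc n)}" for n
  have le: "emeasure M (A n) \<le> ennreal t" for n
  proof -
    have "decr_rearrangement M f t < ennreal (l + 1 / real (Suc n))"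
    proof (rule le_less_trans)
      show "decr_rearrangement M f t \<le> ennreal l"
        using B by (simp only: not_less)
      show "ennreal l < ennreal (l + 1 / real (Suc n))"
        using l by (simp add: ennreal_less_iff)
    qed
    then obtain m where m: "m > 0" "emeasure M {x \<in> space M. f x > m} \<le> ennreal t"
        "ennreal m < ennreal (l + 1 / real (Suc n))"
      unfolding decr_rearrangement_def INF_less_iff by auto
    then have "m < l + 1 / real (Suc n)"
      by (simp add: ennreal_less_iff)
    then have "emeasure M (A n) \<le> emeasure M {x \<in> space M. f x > m}"
      unfolding A_def by (intro emeasure_mono) auto
    with m show ?thesis by simp
  qed
  have "incseq A"
  proof (rule incseq_SucI)
    fix n
    have "1 / real (Suc (Suc n)) \<le> 1 / real (Suc n)"
      by (simp add: frac_le)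
    then show "A n \<le> A (Suc n)"
      unfolding A_def by auto
  qed
  moreover have "range A \<subseteq> sets M"
    unfolding A_def by auto
  moreover have "(\<Union>n. A n) = {x \<in> space M. f x > l}"
  proof (intro equalityI subsetI)
    fix x assume "x \<in> (\<Union>n. A n)"
    then show "x \<in> {x \<in> space M. f x > l}"
      unfolding A_def by (fastforce elim: less_trans[rotated])
  next
    fix x assume x: "x \<in> {x \<in> space M. f x > l}"
    then obtain n where "inverse (real (Suc n)) < f x - l"
      using reals_Archimedean[of "f x - l"] by auto
    with x have "x \<in> A n"
      unfolding A_def by (simp add: inverse_eq_divide)
    then show "x \<in> (\<Union>n. A n)" by blast
  qed
  ultimately have "emeasure M {x \<in> space M. f x > l} = (SUP n. emeasure M (A n))"
    using SUP_emeasure_incseq by metis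
  also have "\<dots> \<le> ennreal t"
    by (intro SUP_least le)
  finally show False using A by simp
qed

lemma (in sigma_finite_measure) nn_integral_decr_rearrangement_powr:
  assumes [measurable]: "f \<in> borel_measurable M" and f: "\<And>x. 0 \<le> f x" and a: "0 < a"
  shows "(\<integral>\<^sup>+ t\<in>{0<..}. enn_powr (decr_rearrangement M f t) a \<partial>lborel)
    = (\<integral>\<^sup>+ x. ennreal (f x powr a) \<partial>M)"
proof -
  interpret P: pair_sigma_finite M "lborel :: real measure" ..
  \<comment> \<open>For \<open>s > 0\<close> this is the measure of the set where
    \<open>f x powr a\<close> exceeds \<open>s\<close>. Both sides of the claim equal the integral
    of \<open>G\<close> over positive \<open>s\<close>.\<close>
  define G where "G s = emeasure M {x \<in> space M. s powr (1 / a) < f x}" for s :: real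
  have [measurable]: "G \<in> borel_measurable borel"
    unfolding G_def by measurable
  have "(\<integral>\<^sup>+ t\<in>{0<..}. enn_powr (decr_rearrangement M f t) a \<partial>lborel)
      = (\<integral>\<^sup>+ t. (\<integral>\<^sup>+ s. indicator {s. 0 < s \<and> ennreal s < enn_powr (decr_rearrangement M f t) a} s
          * indicator {0<..} t \<partial>lborel) \<partial>lborel)"
    by (intro nn_integral_cong)
      (auto simp: nn_integral_indicator_less_ennreal split: split_indicator)
  \<comment> \<open>For positive \<open>s\<close> and \<open>t\<close>, the power of the
    rearrangement at \<open>t\<close> exceeds \<open>s\<close> iff \<open>t\<close> lies below
    \<open>G s\<close>: the region between the axes and the graph is described from the other
    axis.\<close>
  also have "\<dots> = (\<integral>\<^sup>+ t. (\<integral>\<^sup>+ s. indicator {(t, s). 0 < t \<and> 0 < s \<and> ennreal t < G s} (t, s)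
      \<partial>lborel) \<partial>lborel)"
    using a by (intro nn_integral_cong)
      (auto simp: less_enn_powr_iff less_decr_rearrangement_iff G_def split: split_indicator)
  also have "\<dots> = (\<integral>\<^sup>+ s. (\<integral>\<^sup>+ t. indicator {(t, s). 0 < t \<and> 0 < s \<and> ennreal t < G s} (t, s)
      \<partial>lborel) \<partial>lborel)"
    by (rule lborel_pair.Fubini'[symmetric]) (simp add: case_prod_beta')
  \<comment> \<open>For fixed \<open>s > 0\<close> the slice in \<open>t\<close> is an interval of
    length \<open>G s\<close>.\<close>
  also have "\<dots> = (\<integral>\<^sup>+ s. G s * indicator {0<..} s \<partial>lborel)"
  proof (intro nn_integral_cong)
    fix s :: real
    show "(\<integral>\<^sup>+ t. indicator {(t, s). 0 < t \<and> 0 < s \<and> ennreal t < G s} (t, s) \<partial>lborel)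
        = G s * indicator {0<..} s"
      using nn_integral_indicator_less_ennreal[of "G s"]
      by (cases "0 < s") (auto simp: indicator_def)
  qed
  also have "\<dots> = (\<integral>\<^sup>+ s. (\<integral>\<^sup>+ x. indicator {(x, s). 0 < s \<and> s powr (1 / a) < f x} (x, s) \<partial>M) \<partial>lborel)"
  proof (intro nn_integral_cong)
    fix s :: real
    have "G s = (\<integral>\<^sup>+ x. indicator {x \<in> space M. s powr (1 / a) < f x} x \<partial>M)"
      unfolding G_def by simp
    also have "\<dots> = (\<integral>\<^sup>+ x. indicator {x. s powr (1 / a) < f x} x \<partial>M)"
      by (intro nn_integral_cong) (auto split: split_indicator)
    finally show "G s * indicator {0<..} s
        = (\<integral>\<^sup>+ x. indicator {(x, s). 0 < s \<and> s powr (1 / a) < f x} (x, s) \<partial>M)"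
      by (cases "0 < s") (auto simp: indicator_def)
  qed
  also have "\<dots> = (\<integral>\<^sup>+ x. (\<integral>\<^sup>+ s. indicator {(x, s). 0 < s \<and> s powr (1 / a) < f x} (x, s) \<partial>lborel) \<partial>M)"
    by (rule P.Fubini') (simp add: case_prod_beta')
  also have "\<dots> = (\<integral>\<^sup>+ x. (\<integral>\<^sup>+ s. indicator {s. 0 < s \<and> ennreal s < enn_powr (ennreal (f x)) a} s
      \<partial>lborel) \<partial>M)"
    using a by (intro nn_integral_cong)
      (auto simp: less_enn_powr_iff ennreal_less_iff split: split_indicator)
  also have "\<dots> = (\<integral>\<^sup>+ x. ennreal (f x powr a) \<partial>M)"
    by (simp add: nn_integral_indicator_less_ennreal enn_powr_ennreal f)
  finally show ?thesis .
qed

section \<open>The Lorentz quasi-norm as a weighted sum over cubes\<close>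

lemma countable_dyadic_cubes: "countable (dyadic_cubes :: (real ^ 'n::finite) set set)"
proof -
  have "dyadic_cubes = range (\<lambda>(j, k). dyadic_cube j (k :: int ^ 'n))"
    by (auto simp: dyadic_cubes_def)
  then show ?thesis by (metis countable_image countableI_type)
qed

text \<open>There are countably many atoms, each of finite mass. This makes the layer cake formula
  available for \<open>nu \<alpha>\<close>.\<close>

lemma sigma_finite_measure_nu: "sigma_finite_measure (nu \<alpha>)"
proof -
  interpret sigma_finite_measure "count_space dyadic_cubes"
    by (rule sigma_finite_measure_count_space_countable[OF countable_dyadic_cubes])
  show ?thesis
    unfolding nu_def point_measure_def
    by (subst sigma_finite_iff_density_finite) auto
qed

text \<open>With both exponents equal to \<tau>, the factor \<open>t powr (1 / \<tau>)\<close>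
  contributes exactly \<open>t\<close>, which cancels the density \<open>1 / t\<close>. The layer
  cake formula does the rest.\<close>

lemma lorentz_norm_diag:
  assumes "0 < \<tau>"
  shows "lorentz_norm \<tau> \<tau> u (nu \<alpha>) S = enn_powr
    (\<integral>\<^sup>+ Q. ennreal (cmod (of_real (u Q) * S Q) powr \<tau> * vol Q powr \<alpha>) \<partial>count_space dyadic_cubes) (1 / \<tau>)"
proof -
  interpret sigma_finite_measure "nu \<alpha> :: (real ^ 'n) set measure"
    by (rule sigma_finite_measure_nu)
  define d where "d Q = cmod (of_real (u Q) * S Q)" for Q
  have sp: "space (nu \<alpha>) = dyadic_cubes"
    by (simp add: nu_def space_point_measure)
  have [measurable]: "d \<in> borel_measurable (nu \<alpha>)"
    by (simp add: nu_def)
  \<comment> \<open>The value \<open>undefined\<close> outside the dyadic cubes is harmless, since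
    the superlevel sets only contain dyadic cubes.\<close>
  have re: "rearrangement (nu \<alpha>) (\<lambda>Q\<in>dyadic_cubes. of_real (u Q) * S Q) t
      = decr_rearrangement (nu \<alpha>) d t" for t
  proof -
    have "{Q \<in> dyadic_cubes. cmod ((\<lambda>Q\<in>dyadic_cubes. of_real (u Q) * S Q) Q) > l}
        = {Q \<in> space (nu \<alpha>). d Q > l}" for l
      by (auto simp: d_def sp)
    then show ?thesis
      unfolding rearrangement_def decr_rearrangement_def by simp
  qed
  have "(\<integral>\<^sup>+ t\<in>{0<..}. enn_powr (ennreal (t powr (1 / \<tau>)) * decr_rearrangement (nu \<alpha>) d t) \<tau>
          * ennreal (1 / t) \<partial>lborel)
      = (\<integral>\<^sup>+ t\<in>{0<..}. enn_powr (decr_rearrangement (nu \<alpha>) d t) \<tau> \<partial>lborel)"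
  proof (intro nn_integral_cong)
    fix t :: real
    have "ennreal t * x * ennreal (1 / t) = x" if "0 < t" for x
    proof -
      have "ennreal t * x * ennreal (1 / t) = ennreal (t * (1 / t)) * x"
        using that by (subst ennreal_mult) (auto simp: ac_simps)
      then show ?thesis using that by simp
    qed
    then show "enn_powr (ennreal (t powr (1 / \<tau>)) * decr_rearrangement (nu \<alpha>) d t) \<tau>
          * ennreal (1 / t) * indicator {0<..} t
      = enn_powr (decr_rearrangement (nu \<alpha>) d t) \<tau> * indicator {0<..} t"
      using assms by (auto simp: enn_powr_mult_ennreal powr_powr split: split_indicator)
  qed
  also have "\<dots> = (\<integral>\<^sup>+ Q. ennreal (d Q powr \<tau>) \<partial>nu \<alpha>)"
    using assms by (intro nn_integral_decr_rearrangement_powr) (auto simp: d_def)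
  also have "\<dots> = (\<integral>\<^sup>+ Q. ennreal (d Q powr \<tau> * vol Q powr \<alpha>) \<partial>count_space dyadic_cubes)"
    unfolding nu_def point_measure_def
    by (subst nn_integral_density) (auto simp: ac_simps simp flip: ennreal_mult)
  finally show ?thesis
    unfolding lorentz_norm_def re d_def by simp
qed

section \<open>The Besov quasi-norm as a weighted sum over cubes\<close>

lemma nn_integral_count_space_partition:
  assumes "\<And>x. x \<in> A \<Longrightarrow> \<exists>!j. x \<in> B j" and "\<And>j. B j \<subseteq> A"
  shows "(\<integral>\<^sup>+ j. (\<integral>\<^sup>+ x. f x \<partial>count_space (B j)) \<partial>count_space UNIV) = (\<integral>\<^sup>+ x. f x \<partial>count_space A)"
proof -
  have "(\<integral>\<^sup>+ j. (\<integral>\<^sup>+ x. f x \<partial>count_space (B j)) \<partial>count_space UNIV)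
      = (\<integral>\<^sup>+ j. (\<integral>\<^sup>+ x. f x * indicator (B j) x \<partial>count_space UNIV) \<partial>count_space UNIV)"
    by (simp add: nn_integral_count_space_indicator)
  \<comment> \<open>Once the sums are exchanged, exactly one \<open>j\<close> contributes for each
    \<open>x\<close> in \<open>A\<close>, and none for other \<open>x\<close>.\<close>
  also have "\<dots> = (\<integral>\<^sup>+ x. (\<integral>\<^sup>+ j. f x * indicator (B j) x \<partial>count_space UNIV) \<partial>count_space UNIV)"
    using nn_integral_fst_count_space[of "\<lambda>(j, x). f x * indicator (B j) x"]
      nn_integral_snd_count_space[of "\<lambda>(j, x). f x * indicator (B j) x"] by simp
  also have "\<dots> = (\<integral>\<^sup>+ x. f x * indicator A x \<partial>count_space UNIV)"
  proof (intro nn_integral_cong)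
    fix x
    show "(\<integral>\<^sup>+ j. f x * indicator (B j) x \<partial>count_space UNIV) = f x * indicator A x"
    proof (cases "x \<in> A")
      case True
      then obtain i where i: "x \<in> B i" "\<And>j. x \<in> B j \<Longrightarrow> j = i"
        using assms(1) by metis
      have "(\<integral>\<^sup>+ j. f x * indicator (B j) x \<partial>count_space UNIV) = (\<Sum>j\<in>{i}. f x * indicator (B j) x)"
      proof (rule nn_integral_count_space')
        show "f x * indicator (B j) x = 0" if "j \<notin> {i}" for j
        proof -
          have "x \<notin> B j" using i(2) that by blast
          then show ?thesis by simp
        qed
      qed auto
      then show ?thesis using True i(1) by simp
    next
      case False
      then have "x \<notin> B j" for j using assms(2) by blast
      with False show ?thesis by simp
    qed
  qed
  finally show ?thesis
    by (simp add: nn_integral_count_space_indicator)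
qed

lemma ex1_dyadic_level:
  fixes Q :: "(real ^ 'n::finite) set"
  assumes "Q \<in> dyadic_cubes"
  shows "\<exists>!j. vol Q = 2 powi (- j * int CARD('n))"
proof -
  obtain j k where Q: "Q = dyadic_cube j k"
    using assms by (auto simp: dyadic_cubes_def)
  have "vol Q = (2 powi (- j)) ^ CARD('n)"
    by (simp add: Q measure_def emeasure_dyadic_cube)
  also have "\<dots> = 2 powi (- j * int CARD('n))"
    by (simp only: power_int_mult power_int_of_nat)
  finally have "vol Q = 2 powi (- j * int CARD('n))" .
  moreover have "j = i" if "(2::real) powi (- j * int CARD('n)) = 2 powi (- i * int CARD('n))" for i
  proof -
    have "- j * int CARD('n) = - i * int CARD('n)"
      using that by (metis linorder_neq_iff one_less_numeral_iff power_int_strict_increasing semiring_norm(76))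
    \<comment> \<open>The dimension is positive, so it cancels.\<close>
    then show ?thesis by simp
  qed
  ultimately show ?thesis by metis
qed

text \<open>With equal exponents the outer power \<tau> undoes the inner root, and the sums over the
  levels merge into one sum over all cubes.\<close>

lemma b_norm_diag:
  fixes S :: "'n::finite dyadic_seq"
  assumes "0 < \<tau>"
  shows "b_norm \<gamma> (ennreal \<tau>) (ennreal \<tau>) S = enn_powr
    (\<integral>\<^sup>+ Q. ennreal ((vol Q powr (- \<gamma> / real CARD('n) + 1 / \<tau> - 1/2) * cmod (S Q)) powr \<tau>)
      \<partial>count_space dyadic_cubes) (1 / \<tau>)"
proof -
  have r: "enn2real (1 / ennreal \<tau>) = 1 / \<tau>"
    using assms by (simp add: divide_ennreal flip: ennreal_1)
  have "(\<integral>\<^sup>+ j. (\<integral>\<^sup>+ Q. f Q \<partial>count_space {Q \<in> dyadic_cubes. vol Q = 2 powi (- j * int CARD('n))})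
      \<partial>count_space UNIV) = (\<integral>\<^sup>+ Q. f Q \<partial>count_space dyadic_cubes)"
    for f :: "(real ^ 'n) set \<Rightarrow> ennreal"
  proof (rule nn_integral_count_space_partition)
    fix Q :: "(real ^ 'n) set" assume "Q \<in> dyadic_cubes"
    then show "\<exists>!j. Q \<in> {Q \<in> dyadic_cubes. vol Q = 2 powi (- j * int CARD('n))}"
      using ex1_dyadic_level[of Q] by simp
  qed auto
  then show ?thesis
    using assms by (simp add: b_norm_def lr_norm_def r enn_powr_inverse enn_powr_ennreal)
qed

theorem lemma2p10p4:
  fixes s1 s2 p1 p2 \<tau> \<alpha> \<gamma> :: real and q2 :: ennreal
    and u :: "(real ^ 'n::finite) set \<Rightarrow> real"
  assumes "0 < p1" "0 < p2" "0 < q2" "0 < \<tau>"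
    and "\<alpha> = p1 * ((s2 - s1) / real CARD('n) - 1 / p2) + 1"
    and "u = (\<lambda>Q. enn2real (f_norm s2 p2 q2 (unit_seq Q)))"
    and "\<gamma> = s1 + real CARD('n) * (1 / \<tau> - 1 / p1) * (1 - \<alpha>)"
  shows "lorentz_space \<tau> \<tau> u (nu \<alpha>) = b_space \<gamma> (ennreal \<tau>) (ennreal \<tau>)
    \<and> (\<forall>S \<in> b_space \<gamma> (ennreal \<tau>) (ennreal \<tau>).
          lorentz_norm \<tau> \<tau> u (nu \<alpha>) S = b_norm \<gamma> (ennreal \<tau>) (ennreal \<tau>) S)"
proof -
  have weight: "cmod (of_real (u Q) * z) powr \<tau> * vol Q powr \<alpha>
      = (vol Q powr (- \<gamma> / real CARD('n) + 1 / \<tau> - 1/2) * cmod z) powr \<tau>"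
    if Q: "Q \<in> dyadic_cubes" for Q :: "(real ^ 'n) set" and z
  proof -
    have vol: "vol Q > 0"
      using dyadic_cubes_facts[OF Q] by simp
    have u: "u Q = vol Q powr (- s2 / real CARD('n) + 1 / p2 - 1/2)"
      using assms Q by (simp add: f_norm_unit_seq)
    \<comment> \<open>The choice of \<alpha> means (1 - \<alpha>) / p1 = 1 / p2 - (s2 - s1) / d,
      with d the dimension. Inserted into \<gamma>, this cancels \<open>s1\<close>, and the
      exponents of the volume agree.\<close>
    have "(- s2 / real CARD('n) + 1 / p2 - 1/2) * \<tau> + \<alpha>
        = (- \<gamma> / real CARD('n) + 1 / \<tau> - 1/2) * \<tau>"
      unfolding assms(5,7) using assms(1,2,4) by (simp add: field_simps)
    then have "vol Q powr ((- s2 / real CARD('n) + 1 / p2 - 1/2) * \<tau>) * vol Q powr \<alpha>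
        = vol Q powr ((- \<gamma> / real CARD('n) + 1 / \<tau> - 1/2) * \<tau>)"
      by (simp only: powr_add[symmetric])
    then show ?thesis
      by (simp add: u norm_mult powr_mult powr_powr ac_simps)
  qed
  \<comment> \<open>The sums agree term by term for every \<open>S\<close>, also when they are
    infinite, so the two spaces impose the same finiteness condition.\<close>
  have "lorentz_norm \<tau> \<tau> u (nu \<alpha>) S = b_norm \<gamma> (ennreal \<tau>) (ennreal \<tau>) S" for S
    unfolding lorentz_norm_diag[OF assms(4)] b_norm_diag[OF assms(4)]
    by (intro arg_cong[where f = "\<lambda>x. enn_powr x _"] nn_integral_cong) (simp add: weight)
  then show ?thesis
    by (simp add: lorentz_space_def b_space_def)
qed

end
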